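(* Let $G$ be a distance-regular graph of valency $k$ and diameter $d$, let $D=d+1$, let $\tilde{Q}=\frac1k Q$ where $Q$ is its quotient matrix, and write $\varphi(x)=\det(xI_D-\tilde{Q})=\sum_{i=0}^{D}\rho_i x^i$. If $G$ is periodic, then $2^j\rho_{D-j}\in\mathbb{Z}$ for every $j\in\{1,\dots,D-1\}$.
   Context: A finite connected $k$-regular graph $G$ of diameter $d$ is distance-regular if there are numbers $c_j,a_j,b_j$ ($0\le j\le d$) such that for all vertices $x$ and all $y$ at distance $j$ from $x$, $y$ has exactly $c_j$ neighbours at distance $j-1$, $a_j$ at distance $j$, and $b_j$ at distance $j+1$ from $x$ (with $c_0=b_d=0$). Its quotient matrix $Q$ is the $(d+1)\times(d+1)$ tridiagonal matrix with rows/columns indexed $0,\dots,d$, diagonal entries $Q_{j,j}=a_j$, superdiagonal entries $Q_{j,j+1}=b_j$ and subdiagonal entries $Q_{j+1,j}=c_{j+1}$. For a finite simple graph $G=(V,E)$, let $\mathcal{A}(G)=\{(u,v),(v,u) : uv\in E\}$; for an arc $e=(u,v)$ write $o(e)=u$, $t(e)=v$, $e^{-1}=(v,u)$. The Grover transfer matrix $U$ is indexed by $\mathcal{A}(G)$ with $U_{e,f}=2/\deg(t(f))$ if $t(f)=o(e)$ and $e\neq f^{-1}$; $U_{e,f}=2/\deg(t(f))-1$ if $e=f^{-1}$; $U_{e,f}=0$ otherwise. $G$ is periodic if $U^m=I$ for some positive integer $m$. *)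

theory Defs
  imports
    "Graph_Theory.Graph_Theory"
    "Jordan_Normal_Form.Char_Poly"
begin

text \<open>
  Finite simple graphs are the loop-free finite symmetric digraphs \<^term>\<open>G\<close> with
  \<^prop>\<open>pair_graph G\<close>: the arcs are ordered pairs of vertices, and an undirected edge
  \<open>uv\<close> is represented by the two arcs \<open>(u, v)\<close> and \<open>(v, u)\<close>. Thus \<^term>\<open>parcs G\<close>
  is the arc set \<open>\<A>(G)\<close>, with origin \<^const>\<open>fst\<close>, terminus \<^const>\<open>snd\<close> and inverse
  \<^const>\<open>prod.swap\<close>.
\<close>

definition graph_degree :: "'a pair_pre_digraph \<Rightarrow> 'a \<Rightarrow> nat" where
  "graph_degree G v = out_degree (with_proj G) v"

definition graph_dist :: "'a pair_pre_digraph \<Rightarrow> 'a \<Rightarrow> 'a \<Rightarrow> ereal" where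
  "graph_dist G u v = wf_digraph.\<mu> (with_proj G) (\<lambda>_. 1) u v"

definition graph_diameter :: "'a pair_pre_digraph \<Rightarrow> ereal" where
  "graph_diameter G = (SUP u\<in>pverts G. SUP v\<in>pverts G. graph_dist G u v)"

text \<open>
  Since distances are extended reals, the condition defining \<open>c 0\<close> refers to the
  impossible distance \<open>-1\<close>.
\<close>

definition distance_regular ::
  "'a pair_pre_digraph \<Rightarrow> nat \<Rightarrow> nat \<Rightarrow> (nat \<Rightarrow> nat) \<Rightarrow> (nat \<Rightarrow> nat) \<Rightarrow> (nat \<Rightarrow> nat) \<Rightarrow> bool"
where
  "distance_regular G k d c a b \<longleftrightarrow>
     pair_graph G \<and> Digraph_Component.connected (with_proj G) \<and>
     (\<forall>v\<in>pverts G. graph_degree G v = k) \<and>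
     graph_diameter G = ereal (real d) \<and>
     (\<forall>j\<le>d. \<forall>x\<in>pverts G. \<forall>y\<in>pverts G. graph_dist G x y = ereal (real j) \<longrightarrow>
        card {z. (y, z) \<in> parcs G \<and> graph_dist G x z = ereal (real j - 1)} = c j \<and>
        card {z. (y, z) \<in> parcs G \<and> graph_dist G x z = ereal (real j)} = a j \<and>
        card {z. (y, z) \<in> parcs G \<and> graph_dist G x z = ereal (real j + 1)} = b j) \<and>
     c 0 = 0 \<and> b d = 0"

definition quotient_matrix ::
  "nat \<Rightarrow> (nat \<Rightarrow> nat) \<Rightarrow> (nat \<Rightarrow> nat) \<Rightarrow> (nat \<Rightarrow> nat) \<Rightarrow> real mat"
where
  "quotient_matrix d c a b = mat (d + 1) (d + 1) (\<lambda>(i, j).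
     if j = i then real (a i)
     else if j = i + 1 then real (b i)
     else if i = j + 1 then real (c i)
     else 0)"

definition grover_entry :: "'a pair_pre_digraph \<Rightarrow> 'a \<times> 'a \<Rightarrow> 'a \<times> 'a \<Rightarrow> real" where
  "grover_entry G e f =
     (if snd f = fst e \<and> e \<noteq> prod.swap f then 2 / real (graph_degree G (snd f))
      else if e = prod.swap f then 2 / real (graph_degree G (snd f)) - 1
      else 0)"

text \<open>
  Matrices in the library are indexed by initial segments of the naturals, so the matrix
  indexed by the arcs is written with respect to an enumeration \<open>es\<close> of the arcs. Another
  enumeration conjugates it by a permutation matrix; hence periodicity does not depend on
  the enumeration.
\<close>

definition grover_matrix :: "'a pair_pre_digraph \<Rightarrow> ('a \<times> 'a) list \<Rightarrow> real mat" where
  "grover_matrix G es =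
     mat (length es) (length es) (\<lambda>(i, j). grover_entry G (es ! i) (es ! j))"

definition periodic_graph :: "'a pair_pre_digraph \<Rightarrow> bool" where
  "periodic_graph G \<longleftrightarrow>
     (\<exists>es. distinct es \<and> set es = parcs G \<and>
        (\<exists>m>0. grover_matrix G es ^\<^sub>m m = 1\<^sub>m (length es)))"

end

theory Submission
  (* With the imports swapped, coeff would denote the coefficient function of HOL-Algebra. *)
  imports "Berlekamp_Zassenhaus.Factor_Bound" Defs
begin

text \<open>
  An eigenvector \<open>v\<close> of \<open>Q / k\<close> for \<open>\<mu>\<close> lifts, through the distance from a vertex of
  eccentricity \<open>d\<close>, to an eigenfunction of the simple random walk. Each root \<open>z\<close> of
  \<open>z\<^sup>2 - 2 \<mu> z + 1\<close> is then \<open>1\<close>, \<open>-1\<close> or an eigenvalue of the Grover matrix \<open>U\<close>, so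
  \<open>U\<^sup>m = I\<close> makes \<open>2 \<mu> = z + 1 / z\<close> a root of the monic integer polynomial
  \<open>(x\<^sup>2 - 4) (T - 2)\<close>, where \<open>T (z + 1 / z) = z\<^sup>m + z\<^sup>-\<^sup>m\<close>. Hence the monic rational
  polynomial \<open>2\<^sup>D \<phi> (x / 2)\<close> divides a power of that polynomial, and has integer
  coefficients by Gauss' lemma.
\<close>

section \<open>Monic rational polynomials with integral roots\<close>

text \<open>Gauss' lemma: a monic \<open>p\<close> is primitive, so it is the product of the
  primitive parts \<open>rg\<close> and \<open>sh\<close> of \<open>g\<close> and its cofactor.
  Their leading coefficients are then units, and the positive scalar \<open>r\<close> between
  \<open>g\<close> and \<open>rg\<close> must be 1.\<close>

lemma monic_factor_int_coeffs:
  fixes g :: "rat poly" and p :: "int poly"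
  assumes g: "lead_coeff g = 1" and p: "lead_coeff p = 1" and dvd: "g dvd map_poly of_int p"
  shows "coeff g i \<in> \<int>"
proof -
  obtain h where gh: "map_poly rat_of_int p = g * h"
    using dvd by (auto elim: dvdE)
  obtain r rg where rg: "rat_to_normalized_int_poly g = (r, rg)"
    by fastforce
  obtain s sh where sh: "rat_to_normalized_int_poly h = (s, sh)"
    by fastforce
  have "content p dvd lead_coeff p"
    by (rule content_dvd_coeff)
  then have "content p = 1"
    using p by simp
  moreover have "p \<noteq> 0"
    using p by auto
  ultimately have "p = rg * sh"
    using gh rg sh rat_to_int_factor_content_1 by blast
  then have "lead_coeff rg * lead_coeff sh = 1"
    using p by (simp add: lead_coeff_mult)
  then have lc: "lead_coeff rg = 1 \<or> lead_coeff rg = -1"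
    using zmult_eq_1_iff by blast
  have g_eq: "g = smult r (map_poly of_int rg)" and r: "r > 0"
    using rat_to_normalized_int_poly[OF rg] by auto
  have "r * of_int (lead_coeff rg) = 1"
    using g r unfolding g_eq by simp
  with lc r have "r = 1"
    by auto
  then show ?thesis
    unfolding g_eq by (simp add: coeff_map_poly)
qed

text \<open>Over the complex numbers \<open>g\<close> splits into linear factors that all divide
  \<open>p\<close>, so \<open>g\<close> divides a power of \<open>p\<close>, which absorbs multiple
  roots. Gauss' lemma applies to that power, since it is still monic.\<close>

lemma monic_rat_poly_int_coeffs:
  fixes g :: "rat poly" and p :: "int poly"
  assumes g: "lead_coeff g = 1" and p: "lead_coeff p = 1"
    and root: "\<And>x :: complex. poly (map_poly of_rat g) x = 0 \<Longrightarrow> poly (map_poly of_int p) x = 0"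
  shows "coeff g i \<in> \<int>"
proof -
  let ?G = "map_poly of_rat g :: complex poly" and ?P = "map_poly of_int p :: complex poly"
  obtain as where "smult (lead_coeff ?G) (\<Prod>a\<leftarrow>as. [:- a, 1:]) = ?G"
    using fundamental_theorem_algebra_factorized by blast
  then have G: "?G = (\<Prod>a\<leftarrow>as. [:- a, 1:])"
    using g by simp
  have "\<forall>a\<in>set as. poly ?P a = 0"
    using root unfolding G by (auto simp: poly_prod_list prod_list_zero_iff)
  then have "(\<Prod>a\<leftarrow>as. [:- a, 1:]) dvd ?P ^ length as"
  proof (induction as)
    case (Cons a as)
    then show ?case
      unfolding list.map prod_list.Cons list.size(4) add_Suc_right add_0_right power_Suc
      by (intro mult_dvd_mono) (auto simp: poly_eq_0_iff_dvd)
  qed simp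
  \<comment> \<open>Reading the integer polynomial through the rationals lets divisibility descend
    from complex to rational polynomials.\<close>
  then have "?G dvd map_poly of_rat (map_poly of_int (p ^ length as))"
    unfolding G by (simp add: map_poly_map_poly o_def flip: of_int_poly_hom.hom_power)
  then have "g dvd map_poly of_int (p ^ length as)"
    by (rule of_rat_hom.dvd_map_poly_hom_imp_dvd)
  moreover have "lead_coeff (p ^ length as) = 1"
    using p by (simp add: lead_coeff_power)
  ultimately show ?thesis
    using g monic_factor_int_coeffs by blast
qed

section \<open>Dickson polynomials and doubled cosines\<close>

text \<open>Dickson polynomials with parameter 1: twice the Chebyshev polynomial of the first kind,
  taken at \<open>x / 2\<close>.\<close>

fun dickson_poly :: "nat \<Rightarrow> int poly" where
  "dickson_poly 0 = [:2:]"
| "dickson_poly (Suc 0) = [:0, 1:]"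
| "dickson_poly (Suc (Suc n)) = [:0, 1:] * dickson_poly (Suc n) - dickson_poly n"

lemma poly_dickson_poly:
  fixes z :: "'a :: field_char_0"
  assumes "z \<noteq> 0"
  shows "poly (map_poly of_int (dickson_poly n)) (z + 1 / z) = z ^ n + 1 / z ^ n"
proof (induction n rule: dickson_poly.induct)
  case (3 n)
  have "poly (map_poly of_int (dickson_poly (Suc (Suc n)))) (z + 1 / z) =
      (z + 1 / z) * (z ^ Suc n + 1 / z ^ Suc n) - (z ^ n + 1 / z ^ n)"
    unfolding dickson_poly.simps 3[symmetric]
    by (simp add: of_int_poly_hom.hom_mult of_int_poly_hom.hom_minus of_int_hom.map_poly_pCons_hom)
  also have "\<dots> = z ^ Suc (Suc n) + 1 / z ^ Suc (Suc n)"
    using assms by (simp add: field_simps)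
  finally show ?case .
qed simp_all

lemma dickson_poly_monic:
  "degree (dickson_poly (Suc n)) = Suc n \<and> lead_coeff (dickson_poly (Suc n)) = 1"
proof (induction n rule: less_induct)
  case (less n)
  show ?case
  proof (cases n)
    case (Suc k)
    let ?p = "[:0, 1:] * dickson_poly (Suc k)"
    have IH: "degree (dickson_poly (Suc k)) = Suc k" "lead_coeff (dickson_poly (Suc k)) = 1"
      using less.IH[of k] Suc by auto
    have "dickson_poly (Suc k) \<noteq> 0"
      using IH(2) by auto
    then have p: "degree ?p = Suc (Suc k)" "lead_coeff ?p = 1"
      using IH by (simp_all add: degree_mult_eq)
    \<comment> \<open>The case \<open>k = 0\<close> lies outside the induction hypothesis: there the
      polynomial is the constant 2.\<close>
    have "degree (dickson_poly k) < Suc (Suc k)"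
      using less.IH[of "k - 1"] Suc by (cases k) auto
    then have "degree (- dickson_poly k) < degree ?p"
      using p by simp
    then have "degree (?p + (- dickson_poly k)) = degree ?p"
      "lead_coeff (?p + (- dickson_poly k)) = lead_coeff ?p"
      by (rule degree_add_eq_left, metis lead_coeff_add_le add.commute)
    then show ?thesis
      unfolding Suc using p by simp
  qed simp
qed

text \<open>The quadratic factor has the roots 2 and -2, which belong to \<open>z = 1\<close> and
  \<open>z = -1\<close>. The other factor can miss -2: for odd \<open>m\<close>,
  \<open>dickson_poly m\<close> takes the value -2 there.\<close>

definition two_cos_poly :: "nat \<Rightarrow> int poly" where
  "two_cos_poly m = [:-4, 0, 1:] * (dickson_poly m + [:- 2:])"

lemma lead_coeff_two_cos_poly:
  assumes "m > 0"
  shows "lead_coeff (two_cos_poly m) = 1"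
proof -
  obtain n where m: "m = Suc n"
    using assms by (cases m) auto
  have "lead_coeff (dickson_poly m + [:- 2:]) = 1"
    using dickson_poly_monic[of n] unfolding m
    by (metis add.commute degree_pCons_0 lead_coeff_add_le zero_less_Suc)
  then show ?thesis
    unfolding two_cos_poly_def lead_coeff_mult by simp
qed

lemma poly_two_cos_poly:
  fixes z \<mu> :: complex
  assumes z: "z\<^sup>2 - 2 * \<mu> * z + 1 = 0" and pow: "z\<^sup>2 = 1 \<or> z ^ m = 1"
  shows "poly (map_poly of_int (two_cos_poly m)) (2 * \<mu>) = 0"
proof -
  have z0: "z \<noteq> 0"
    using z by auto
  have \<mu>: "2 * \<mu> = z + 1 / z"
    using z z0 by (simp add: field_simps power2_eq_square)
  show ?thesis
    using pow
  proof
    assume "z\<^sup>2 = 1"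
    then have "z = 1 \<or> z = -1"
      using power2_eq_1_iff by blast
    then show ?thesis
      unfolding two_cos_poly_def \<mu> of_int_poly_hom.hom_mult poly_mult by auto
  next
    assume "z ^ m = 1"
    then show ?thesis
      using poly_dickson_poly[OF z0, of m]
      unfolding two_cos_poly_def \<mu> of_int_poly_hom.hom_mult poly_mult
      by (simp add: of_int_poly_hom.hom_add)
  qed
qed

section \<open>Distances in connected graphs\<close>

lemma symmetric_connected_reachable:
  assumes "pair_graph G" "Digraph_Component.connected (with_proj G)" "x \<in> pverts G" "y \<in> pverts G"
  shows "x \<rightarrow>\<^sup>*\<^bsub>with_proj G\<^esub> y"
proof -
  interpret pair_graph G by fact
  have "strongly_connected (with_proj G)"
    by (rule symmetric_connected_imp_strongly_connected) (use assms(2) pair_sym_arcs in auto)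
  then show ?thesis
    using assms(3,4) by auto
qed

text \<open>A natural number can index vectors and matrices. An infinite distance would be sent to
  0, hence the connectedness hypotheses below.\<close>

definition vertex_dist :: "'a pair_pre_digraph \<Rightarrow> 'a \<Rightarrow> 'a \<Rightarrow> nat" where
  "vertex_dist G x y = nat \<lfloor>real_of_ereal (graph_dist G x y)\<rfloor>"

text \<open>Some walk attains the minimum cost, and with unit weights its cost is its
  length.\<close>

lemma graph_dist_eq_vertex_dist:
  assumes "pair_graph G" "Digraph_Component.connected (with_proj G)" "x \<in> pverts G" "y \<in> pverts G"
  shows "graph_dist G x y = ereal (real (vertex_dist G x y))"
proof -
  interpret pair_graph G by fact
  obtain p where "\<mu> (\<lambda>_. 1) x y = awalk_cost (\<lambda>_. 1) p"
    using min_cost_awalk[of x y "\<lambda>_. 1"] symmetric_connected_reachable[OF assms] by auto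
  moreover have "awalk_cost (\<lambda>_. 1) p = real (length p)"
    by (simp add: awalk_cost_def sum_list_triv)
  ultimately show ?thesis
    by (simp add: vertex_dist_def graph_dist_def)
qed

lemma vertex_dist_arc_le:
  assumes "pair_graph G" "Digraph_Component.connected (with_proj G)" "x \<in> pverts G" "(y, z) \<in> parcs G"
  shows "vertex_dist G x z \<le> vertex_dist G x y + 1"
proof -
  interpret pair_graph G by fact
  have yz: "y \<in> pverts G" "z \<in> pverts G"
    using assms(4) by (auto dest: in_arcsD1 in_arcsD2)
  have "graph_dist G x z \<le> graph_dist G x y + ereal 1"
    unfolding graph_dist_def
    using assms(4) by (intro pos_cost_mu_triangle[of "\<lambda>_. 1" "(y, z)" y z]) (auto simp: arc_to_ends_def)
  then show ?thesis
    using graph_dist_eq_vertex_dist[OF assms(1-3)] yz by simp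
qed

text \<open>\<open>z\<close> is the last vertex before \<open>y\<close> on a shortest walk from
  \<open>x\<close>.\<close>

lemma vertex_dist_pred:
  assumes "pair_graph G" "Digraph_Component.connected (with_proj G)" "x \<in> pverts G" "y \<in> pverts G"
    and "vertex_dist G x y = Suc n"
  obtains z where "(z, y) \<in> parcs G" "vertex_dist G x z = n"
proof -
  interpret pair_graph G by fact
  have "x \<noteq> y"
  proof
    assume "x = y"
    then have "graph_dist G x y \<le> ereal 0"
      using min_cost_le_walk_cost[of x "[]" x "\<lambda>_. 1"] assms(3)
      by (simp add: graph_dist_def awalk_Nil_iff)
    then show False
      using graph_dist_eq_vertex_dist[OF assms(1-4)] assms(5) by simp
  qed
  moreover have "x \<rightarrow>\<^sup>*\<^bsub>with_proj G\<^esub> y"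
    by (rule symmetric_connected_reachable[OF assms(1-4)])
  ultimately obtain z e where ze: "\<mu> (\<lambda>_. 1) x y = \<mu> (\<lambda>_. 1) x z + ereal 1" "arc e (z, y)"
    using mu_exact_triangle[of y x "\<lambda>_. 1"] by auto
  then have zy: "(z, y) \<in> parcs G"
    by (auto simp: arc_def)
  then have "z \<in> pverts G"
    by (auto dest: in_arcsD1)
  then have "vertex_dist G x z = n"
    using ze(1) graph_dist_eq_vertex_dist[OF assms(1-3)] assms(4,5)
    by (simp flip: graph_dist_def)
  with zy show thesis
    by (rule that)
qed

text \<open>Stepping back through predecessors lowers the distance by one each time, so no value is
  skipped. This later makes every coordinate of an eigenvector visible at some vertex.\<close>

lemma vertex_dist_attained:
  assumes "pair_graph G" "Digraph_Component.connected (with_proj G)" "x \<in> pverts G" "y \<in> pverts G"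
    and "n \<le> vertex_dist G x y"
  shows "\<exists>z\<in>pverts G. vertex_dist G x z = n"
  using assms(4,5)
proof (induction "vertex_dist G x y - n" arbitrary: y)
  case 0
  then show ?case by auto
next
  case (Suc m)
  interpret pair_graph G by fact
  obtain l where l: "vertex_dist G x y = Suc l"
    using Suc.hyps(2) by (cases "vertex_dist G x y") auto
  obtain z where "(z, y) \<in> parcs G" "vertex_dist G x z = l"
    using vertex_dist_pred[OF assms(1-3) Suc.prems(1) l] by blast
  then show ?case
    using Suc.hyps(2) Suc.prems(2) l Suc.hyps(1)[of z] by (auto dest: in_arcsD1)
qed

lemma vertex_dist_le_diameter:
  assumes "pair_graph G" "Digraph_Component.connected (with_proj G)" "graph_diameter G = ereal (real d)"
    and "x \<in> pverts G" "y \<in> pverts G"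
  shows "vertex_dist G x y \<le> d"
proof -
  have "graph_dist G x y \<le> graph_diameter G"
    unfolding graph_diameter_def using assms(4,5) by (meson SUP_upper2 SUP_upper)
  then show ?thesis
    using assms graph_dist_eq_vertex_dist[OF assms(1,2,4,5)] by simp
qed

lemma diameter_attained:
  assumes "pair_graph G" "Digraph_Component.connected (with_proj G)" "graph_diameter G = ereal (real d)"
  shows "\<exists>x\<in>pverts G. \<exists>y\<in>pverts G. vertex_dist G x y = d"
proof (rule ccontr)
  assume not_thesis: "\<not> ?thesis"
  have ne: "vertex_dist G x y \<noteq> d" if "x \<in> pverts G" "y \<in> pverts G" for x y
    using that not_thesis by blast
  have less: "vertex_dist G x y < d" if "x \<in> pverts G" "y \<in> pverts G" for x y
    using ne[OF that] vertex_dist_le_diameter[OF assms that] by simp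
  interpret pair_graph G by fact
  \<comment> \<open>The distance of a vertex to itself is below \<open>d\<close>, so
    \<open>d > 0\<close> and \<open>d - 1\<close> is not truncated.\<close>
  obtain x where "x \<in> pverts G"
    using assms(2) by (auto simp: connected_conv)
  then have "d > 0"
    using less[of x x] by simp
  have "graph_dist G x y \<le> ereal (real (d - 1))" if "x \<in> pverts G" "y \<in> pverts G" for x y
    using less[OF that] graph_dist_eq_vertex_dist[OF assms(1,2) that] by simp
  then have "graph_diameter G \<le> ereal (real (d - 1))"
    unfolding graph_diameter_def by (intro SUP_least)
  then show False
    using assms(3) \<open>d > 0\<close> by simp
qed

section \<open>Neighbour counts and the quotient matrix\<close>

lemma card_neighbours:
  assumes "pair_graph G"
  shows "card {w. (u, w) \<in> parcs G} = graph_degree G u"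
proof -
  have "out_arcs (with_proj G) u = Pair u ` {w. (u, w) \<in> parcs G}"
    by (auto simp: out_arcs_def)
  then show ?thesis
    by (simp add: graph_degree_def out_degree_def card_image inj_on_def)
qed

lemma finite_neighbours:
  assumes "pair_graph G"
  shows "finite {w. (u, w) \<in> parcs G}"
proof -
  interpret pair_graph G by fact
  have "{w. (u, w) \<in> parcs G} \<subseteq> pverts G"
    by (auto dest: in_arcsD2)
  then show ?thesis
    by (rule finite_subset) simp
qed

text \<open>The distance classes of \<open>x\<close> form an equitable partition, and the row of the
  quotient matrix for the class of \<open>y\<close> counts the neighbours of \<open>y\<close> class
  by class. Thus adjacency acts on functions of the distance from \<open>x\<close> as the quotient
  matrix acts on vectors.\<close>

lemma sum_over_neighbours:
  fixes v :: "nat \<Rightarrow> complex"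
  assumes dr: "distance_regular G k d c a b" and x: "x \<in> pverts G" and y: "y \<in> pverts G"
  shows "(\<Sum>z | (y, z) \<in> parcs G. v (vertex_dist G x z)) =
    (\<Sum>i\<le>d. of_real (quotient_matrix d c a b $$ (vertex_dist G x y, i)) * v i)"
proof -
  let ?N = "{z. (y, z) \<in> parcs G}" and ?j = "vertex_dist G x y"
  have G: "pair_graph G" "Digraph_Component.connected (with_proj G)" "graph_diameter G = ereal (real d)"
    using dr by (auto simp: distance_regular_def)
  interpret pair_graph G by fact
  have N: "z \<in> pverts G" "(z, y) \<in> parcs G" if "z \<in> ?N" for z
    using that arcs_symmetric by (auto dest: in_arcsD2)
  have fin: "finite ?N"
    by (rule finite_neighbours[OF G(1)])
  have j: "?j \<le> d"
    using vertex_dist_le_diameter[OF G x y] .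
  note dist = graph_dist_eq_vertex_dist[OF G(1,2) x]
  have entry: "quotient_matrix d c a b $$ (?j, i) = real (card {z \<in> ?N. vertex_dist G x z = i})"
    if "i \<le> d" for i
  proof -
    have *: "card {z. (y, z) \<in> parcs G \<and> graph_dist G x z = ereal (real ?j - 1)} = c ?j"
      "card {z. (y, z) \<in> parcs G \<and> graph_dist G x z = ereal (real ?j)} = a ?j"
      "card {z. (y, z) \<in> parcs G \<and> graph_dist G x z = ereal (real ?j + 1)} = b ?j"
      using dr j x y dist[OF y] unfolding distance_regular_def by blast+
    \<comment> \<open>Comparing real numbers keeps \<open>real ?j - 1\<close> meaningful when
      \<open>?j = 0\<close>.\<close>
    have **: "{z. (y, z) \<in> parcs G \<and> graph_dist G x z = ereal t} =
        {z \<in> ?N. real (vertex_dist G x z) = t}" for t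
      using N dist by auto
    consider "i = ?j" | "i = ?j + 1" | "?j = i + 1" | "i > ?j + 1 \<or> ?j > i + 1"
      by linarith
    then show ?thesis
    proof cases
      case 4
      \<comment> \<open>Arcs run both ways, so the distances of adjacent vertices differ by at most
        one; off the three diagonals both sides are 0.\<close>
      have "vertex_dist G x z \<noteq> i" if "z \<in> ?N" for z
        using 4 vertex_dist_arc_le[OF G(1,2) x, of y z] vertex_dist_arc_le[OF G(1,2) x, of z y]
          N[OF that] that by auto
      then have empty: "{z \<in> ?N. vertex_dist G x z = i} = {}"
        by blast
      show ?thesis
        unfolding empty using 4 j that by (auto simp: quotient_matrix_def)
    next
      case 1
      then show ?thesis
        using * j by (simp add: ** quotient_matrix_def)
    next
      case 2
      have "{z \<in> ?N. real (vertex_dist G x z) = real ?j + 1} = {z \<in> ?N. vertex_dist G x z = i}"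
        using 2 by auto
      then show ?thesis
        using * j that 2 by (simp add: ** quotient_matrix_def)
    next
      case 3
      have "{z \<in> ?N. real (vertex_dist G x z) = real ?j - 1} = {z \<in> ?N. vertex_dist G x z = i}"
        using 3 by auto
      then show ?thesis
        using * j that 3 by (simp add: ** quotient_matrix_def)
    qed
  qed
  have "(\<Sum>z\<in>?N. v (vertex_dist G x z)) =
      (\<Sum>i\<le>d. \<Sum>z\<in>{z \<in> ?N. vertex_dist G x z = i}. v (vertex_dist G x z))"
    using fin N vertex_dist_le_diameter[OF G x] by (intro sum.group[symmetric]) auto
  also have "\<dots> = (\<Sum>i\<le>d. of_nat (card {z \<in> ?N. vertex_dist G x z = i}) * v i)"
    by (intro sum.cong) auto
  finally show ?thesis
    by (simp add: entry)
qed

section \<open>Eigenvalues of the Grover matrix\<close>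

text \<open>In the row of \<open>(u, v)\<close> every arc into \<open>u\<close> has weight
  \<open>2 / k\<close>, and the reversed arc \<open>(v, u)\<close>, itself one of these, carries an
  extra -1.\<close>

lemma grover_entry_sum:
  fixes g :: "'a \<times> 'a \<Rightarrow> complex"
  assumes G: "pair_graph G" and deg: "\<forall>v\<in>pverts G. graph_degree G v = k" and uv: "(u, v) \<in> parcs G"
  shows "(\<Sum>e\<in>parcs G. of_real (grover_entry G (u, v) e) * g e) =
    2 / of_nat k * (\<Sum>w | (u, w) \<in> parcs G. g (w, u)) - g (v, u)"
proof -
  interpret pair_graph G by fact
  have vu: "(v, u) \<in> parcs G"
    using uv arcs_symmetric by auto
  have "of_real (grover_entry G (u, v) e) * g e =
      (if snd e = u then 2 / of_nat k * g e else 0) - (if e = (v, u) then g e else 0)"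
    if "e \<in> parcs G" for e
  proof -
    have "graph_degree G (snd e) = k"
      using deg that by (cases e) (auto dest: in_arcsD2)
    then show ?thesis
      by (cases e) (auto simp: grover_entry_def algebra_simps)
  qed
  then have "(\<Sum>e\<in>parcs G. of_real (grover_entry G (u, v) e) * g e) =
      (\<Sum>e\<in>parcs G. if snd e = u then 2 / of_nat k * g e else 0) - g (v, u)"
    using vu by (simp add: sum_subtractf)
  also have "(\<Sum>e\<in>parcs G. if snd e = u then 2 / of_nat k * g e else 0) =
      (\<Sum>e\<in>{e \<in> parcs G. snd e = u}. 2 / of_nat k * g e)"
    by (intro sum.inter_filter[symmetric]) simp
  also have "{e \<in> parcs G. snd e = u} = (\<lambda>w. (w, u)) ` {w. (u, w) \<in> parcs G}"
    using arcs_symmetric by force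
  also have "(\<Sum>e\<in>\<dots>. 2 / of_nat k * g e) = (\<Sum>w | (u, w) \<in> parcs G. 2 / of_nat k * g (w, u))"
    by (subst sum.reindex) (auto simp: inj_on_def)
  finally show ?thesis
    by (simp only: sum_distrib_left)
qed

text \<open>
  If \<open>f\<close> is an eigenfunction of the random walk for the eigenvalue \<open>\<mu>\<close>, then
  \<open>f v - z * f u\<close> on the arcs \<open>(u, v)\<close> is an eigenvector of the Grover matrix for \<open>z\<close>,
  unless it vanishes identically, which forces \<open>z\<^sup>2 = 1\<close>.
\<close>

lemma grover_eigenvalue_root_of_unity:
  fixes f :: "'a \<Rightarrow> complex" and z \<mu> :: complex
  assumes G: "pair_graph G" and deg: "\<forall>v\<in>pverts G. graph_degree G v = k" and k: "k > 0"
    and es: "distinct es" "set es = parcs G"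
    and U: "grover_matrix G es ^\<^sub>m m = 1\<^sub>m (length es)"
    and f: "\<And>u. u \<in> pverts G \<Longrightarrow> (\<Sum>w | (u, w) \<in> parcs G. f w) = of_nat k * \<mu> * f u"
    and x: "x \<in> pverts G" "f x \<noteq> 0"
    and z: "z\<^sup>2 - 2 * \<mu> * z + 1 = 0"
  shows "z\<^sup>2 = 1 \<or> z ^ m = 1"
proof -
  interpret pair_graph G by fact
  define g where "g e = f (snd e) - z * f (fst e)" for e
  let ?n = "length es"
  let ?U = "map_mat complex_of_real (grover_matrix G es)"
  define w where "w = vec ?n (\<lambda>i. g (es ! i))"
  have U_carrier: "grover_matrix G es \<in> carrier_mat ?n ?n"
    by (simp add: grover_matrix_def)
  have sum_g: "(\<Sum>e\<in>parcs G. of_real (grover_entry G e' e) * g e) = z * g e'" if "e' \<in> parcs G" for e'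
  proof -
    obtain u v where e': "e' = (u, v)"
      by fastforce
    have u: "u \<in> pverts G"
      using that e' by (auto dest: in_arcsD1)
    have "(\<Sum>w | (u, w) \<in> parcs G. g (w, u)) = of_nat k * f u - z * (\<Sum>w | (u, w) \<in> parcs G. f w)"
      using card_neighbours[OF G, of u] deg u
      by (simp add: g_def sum_subtractf sum_distrib_left)
    also have "\<dots> = of_nat k * (f u - z * \<mu> * f u)"
      using f[OF u] by (simp add: algebra_simps)
    finally have "(\<Sum>e\<in>parcs G. of_real (grover_entry G e' e) * g e) =
        2 * (f u - z * \<mu> * f u) - (f u - z * f v)"
      using grover_entry_sum[OF G deg, of u v g] that k unfolding e' by (simp add: g_def)
    \<comment> \<open>The error term is a multiple of the quadratic that vanishes at
      \<open>z\<close>.\<close>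
    also have "\<dots> = z * (f v - z * f u) + (z\<^sup>2 - 2 * \<mu> * z + 1) * f u"
      by (simp add: algebra_simps power2_eq_square)
    finally show ?thesis
      using z by (simp add: g_def e')
  qed
  have eigen: "?U *\<^sub>v w = z \<cdot>\<^sub>v w"
  proof (rule eq_vecI)
    fix i assume "i < dim_vec (z \<cdot>\<^sub>v w)"
    then have i: "i < ?n"
      by (simp add: w_def)
    have "(?U *\<^sub>v w) $ i = (\<Sum>j<?n. of_real (grover_entry G (es ! i) (es ! j)) * g (es ! j))"
      using i by (simp add: w_def grover_matrix_def scalar_prod_def lessThan_atLeast0)
    also have "\<dots> = (\<Sum>e\<in>parcs G. of_real (grover_entry G (es ! i) e) * g e)"
      using bij_betw_nth[OF es(1) refl es(2)[symmetric]]
      by (rule sum.reindex_bij_betw)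
    also have "\<dots> = z * g (es ! i)"
      using i es(2) nth_mem by (intro sum_g) blast
    finally show "(?U *\<^sub>v w) $ i = (z \<cdot>\<^sub>v w) $ i"
      using i by (simp add: w_def)
  qed (simp add: w_def grover_matrix_def)
  show ?thesis
  proof (cases "w = 0\<^sub>v ?n")
    case True
    have g0: "g e = 0" if "e \<in> parcs G" for e
    proof -
      obtain i where "i < ?n" "es ! i = e"
        using \<open>e \<in> parcs G\<close> es(2) in_set_conv_nth by metis
      then show ?thesis
        using True by (metis index_vec index_zero_vec(1) w_def)
    qed
    \<comment> \<open>Positive degree gives an edge at \<open>x\<close>. As \<open>g\<close>
      vanishes on both of its arcs, crossing it there and back multiplies \<open>f x\<close> by
      \<open>z\<^sup>2\<close>.\<close>
    have "card {w. (x, w) \<in> parcs G} > 0"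
      using card_neighbours[OF G, of x] deg x k by simp
    then have "{w. (x, w) \<in> parcs G} \<noteq> {}"
      by fastforce
    then obtain y where "(x, y) \<in> parcs G"
      by blast
    moreover from this have "(y, x) \<in> parcs G"
      using arcs_symmetric by auto
    ultimately have "f y = z * f x" "f x = z * f y"
      using g0[of "(x, y)"] g0[of "(y, x)"] by (simp_all add: g_def)
    then have "f x = z\<^sup>2 * f x"
      by (simp add: power2_eq_square)
    then show ?thesis
      using x by simp
  next
    case False
    have "eigenvector ?U w z"
      using False eigen by (simp add: eigenvector_def w_def grover_matrix_def)
    then have "?U ^\<^sub>m m *\<^sub>v w = z ^ m \<cdot>\<^sub>v w"
      using U_carrier by (intro eigenvector_pow[of _ ?n]) auto
    moreover have "?U ^\<^sub>m m = 1\<^sub>m ?n"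
      using U by (simp add: of_real_hom.mat_hom_one flip: of_real_hom.mat_hom_pow[OF U_carrier])
    ultimately have w: "w = z ^ m \<cdot>\<^sub>v w"
      by (simp add: w_def)
    obtain i where i: "i < ?n" "w $ i \<noteq> 0"
      using False by (metis eq_vecI index_zero_vec dim_vec w_def)
    then have "w $ i = z ^ m * w $ i"
      using w by (metis index_smult_vec(1) dim_vec w_def)
    then show ?thesis
      using i by simp
  qed
qed

section \<open>From the quotient matrix to the Grover matrix\<close>

lemma quotient_eigenvalue_two_cos:
  assumes dr: "distance_regular G k d c a b" and d: "d > 0"
    and es: "distinct es" "set es = parcs G"
    and U: "grover_matrix G es ^\<^sub>m m = 1\<^sub>m (length es)"
    and ev: "eigenvalue (map_mat complex_of_real ((1 / real k) \<cdot>\<^sub>m quotient_matrix d c a b)) \<mu>"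
  shows "poly (map_poly of_int (two_cos_poly m)) (2 * \<mu>) = 0"
proof -
  let ?Q = "quotient_matrix d c a b"
  let ?M = "map_mat complex_of_real ((1 / real k) \<cdot>\<^sub>m ?Q)"
  have G: "pair_graph G" "Digraph_Component.connected (with_proj G)" "graph_diameter G = ereal (real d)"
    and deg: "\<forall>v\<in>pverts G. graph_degree G v = k"
    using dr by (auto simp: distance_regular_def)
  interpret pair_graph G by fact
  obtain x y where x: "x \<in> pverts G" and y: "y \<in> pverts G" and xy: "vertex_dist G x y = d"
    using diameter_attained[OF G] by blast
  \<comment> \<open>Since \<open>d > 0\<close>, the vertex \<open>y\<close> has a predecessor on a
    shortest walk from \<open>x\<close>, hence a neighbour.\<close>
  have "k > 0"
  proof -
    obtain e where "(e, y) \<in> parcs G"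
      using vertex_dist_pred[OF G(1,2) x y, of "d - 1"] xy d by auto
    then have "(y, e) \<in> parcs G"
      using arcs_symmetric by auto
    then have "card {w. (y, w) \<in> parcs G} > 0"
      using finite_neighbours[OF G(1)] by (auto simp: card_gt_0_iff)
    then show ?thesis
      using card_neighbours[OF G(1)] deg y by simp
  qed
  obtain v where "eigenvector ?M v \<mu>"
    using ev by (auto simp: eigenvalue_def)
  then have v: "dim_vec v = d + 1" "v \<noteq> 0\<^sub>v (d + 1)" and Mv: "?M *\<^sub>v v = \<mu> \<cdot>\<^sub>v v"
    by (auto simp: eigenvector_def quotient_matrix_def)
  have Qv: "(\<Sum>i\<le>d. of_real (?Q $$ (j, i)) * v $ i) = of_nat k * \<mu> * v $ j" if "j \<le> d" for j
  proof -
    have "(?M *\<^sub>v v) $ j = (\<Sum>i\<le>d. 1 / of_nat k * (of_real (?Q $$ (j, i)) * v $ i))"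
      using that v by (simp add: scalar_prod_def quotient_matrix_def atLeast0LessThan lessThan_Suc_atMost)
    then have "\<mu> * v $ j = 1 / of_nat k * (\<Sum>i\<le>d. of_real (?Q $$ (j, i)) * v $ i)"
      using that v unfolding Mv by (simp add: sum_distrib_left)
    then show ?thesis
      using \<open>k > 0\<close> by (simp add: field_simps)
  qed
  define f where "f u = v $ vertex_dist G x u" for u
  have f: "(\<Sum>w | (u, w) \<in> parcs G. f w) = of_nat k * \<mu> * f u" if "u \<in> pverts G" for u
    using sum_over_neighbours[OF dr x that, of "\<lambda>i. v $ i"] Qv vertex_dist_le_diameter[OF G x that]
    by (simp add: f_def)
  \<comment> \<open>All distances up to \<open>d\<close> occur from \<open>x\<close>, so a nonzero
    coordinate of \<open>v\<close> is a nonzero value of \<open>f\<close>.\<close>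
  obtain i where i: "i \<le> d" "v $ i \<noteq> 0"
    using v by (metis eq_vecI index_zero_vec less_Suc_eq_le Suc_eq_plus1)
  then obtain u where u: "u \<in> pverts G" "f u \<noteq> 0"
    using vertex_dist_attained[OF G(1,2) x y, of i] xy by (auto simp: f_def)
  \<comment> \<open>A root of the quadratic, found by completing the square.\<close>
  define z where "z = \<mu> + csqrt (\<mu>\<^sup>2 - 1)"
  have "(z - \<mu>)\<^sup>2 = \<mu>\<^sup>2 - 1"
    by (simp add: z_def)
  then have z: "z\<^sup>2 - 2 * \<mu> * z + 1 = 0"
    by (simp add: power2_eq_square algebra_simps)
  show ?thesis
    using poly_two_cos_poly[OF z]
      grover_eigenvalue_root_of_unity[OF G(1) deg \<open>k > 0\<close> es U f u z] by blast
qed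

section \<open>Rescaling the characteristic polynomial\<close>

lemma complex_of_real_of_rat: "complex_of_real (of_rat r) = of_rat r"
  by (cases r) (simp add: of_rat_rat)

theorem theorem1p5:
  fixes G :: "'a pair_pre_digraph"
    and k d D :: nat
    and c a b :: "nat \<Rightarrow> nat"
    and \<phi> :: "real poly"
  assumes "distance_regular G k d c a b"
    and "D = d + 1"
    and "\<phi> = char_poly ((1 / real k) \<cdot>\<^sub>m quotient_matrix d c a b)"
    and "periodic_graph G"
  shows "\<forall>j\<in>{1..D - 1}. 2 ^ j * coeff \<phi> (D - j) \<in> \<int>"
proof
  fix j assume j: "j \<in> {1..D - 1}"
  \<comment> \<open>For \<open>d = 0\<close> the range of \<open>j\<close> is empty.\<close>
  then have d: "d > 0"
    using assms(2) by auto
  obtain es m where es: "distinct es" "set es = parcs G" and m: "m > 0"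
    and U: "grover_matrix G es ^\<^sub>m m = 1\<^sub>m (length es)"
    using assms(4) by (auto simp: periodic_graph_def)
  let ?M = "(1 / real k) \<cdot>\<^sub>m quotient_matrix d c a b"
  \<comment> \<open>A rational copy of the scaled quotient matrix: Gauss' lemma needs rational
    coefficients, while the statement is real and the eigenvalues are complex.\<close>
  define R :: "rat mat" where "R = mat D D (\<lambda>(i, j).
    (if j = i then of_nat (a i) else if j = i + 1 then of_nat (b i)
     else if i = j + 1 then of_nat (c i) else 0) / of_nat k)"
  have R: "R \<in> carrier_mat D D"
    by (simp add: R_def)
  have M: "map_mat of_rat R = ?M"
    by (rule eq_matI) (auto simp: R_def quotient_matrix_def assms(2) of_rat_divide)
  have "map_mat (of_rat :: rat \<Rightarrow> complex) R = map_mat of_real (map_mat of_rat R)"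
    by (rule eq_matI) (auto simp: complex_of_real_of_rat)
  then have M_complex: "map_mat of_rat R = map_mat complex_of_real ?M"
    by (simp only: M)
  define \<chi> where "\<chi> = char_poly R"
  have \<phi>: "\<phi> = map_poly of_rat \<chi>"
    unfolding assms(3) \<chi>_def M[symmetric] by (rule of_rat_hom.char_poly_hom[OF R])
  have \<chi>: "degree \<chi> = D" "coeff \<chi> D = 1"
    using degree_monic_char_poly[OF R] by (auto simp: \<chi>_def)
  \<comment> \<open>The roots of \<open>\<psi>\<close> are those of \<open>\<chi>\<close> doubled.
    The factor \<open>2 ^ D\<close> makes it monic and leaves \<open>2 ^ j\<close> on the
    coefficient at \<open>D - j\<close>.\<close>
  define \<psi> where "\<psi> = smult (2 ^ D) (\<chi> \<circ>\<^sub>p [:0, 1 / 2:])"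
  have coeff_\<psi>: "coeff \<psi> i = 2 ^ D * ((1 / 2) ^ i * coeff \<chi> i)" for i
    by (simp add: \<psi>_def coeff_pcompose_linear)
  have "degree \<psi> = D"
    using \<chi> by (simp add: \<psi>_def)
  then have "lead_coeff \<psi> = 1"
    using \<chi>(2) by (simp only: coeff_\<psi>) (simp add: power_one_over)
  moreover have "poly (map_poly of_int (two_cos_poly m)) x = 0"
    if "poly (map_poly of_rat \<psi>) x = 0" for x :: complex
  proof -
    have "poly (map_poly of_rat \<chi>) (x / 2) = 0"
      using that
      by (simp add: \<psi>_def of_rat_hom.map_poly_hom_smult of_rat_hom.map_poly_pcompose
          of_rat_hom.map_poly_pCons_hom poly_pcompose of_rat_divide)
    then have "eigenvalue (map_mat complex_of_real ?M) (x / 2)"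
      using R by (subst eigenvalue_root_char_poly[of _ D])
        (simp_all add: \<chi>_def flip: M_complex of_rat_hom.char_poly_hom[OF R])
    then show ?thesis
      using quotient_eigenvalue_two_cos[OF assms(1) d es U, of "x / 2"] by simp
  qed
  ultimately have "coeff \<psi> (D - j) \<in> \<int>"
    by (rule monic_rat_poly_int_coeffs[OF _ lead_coeff_two_cos_poly[OF m]])
  moreover have "coeff \<psi> (D - j) = 2 ^ j * coeff \<chi> (D - j)"
    using j by (auto simp: coeff_\<psi> power_one_over field_simps simp flip: power_add)
  ultimately obtain i where "2 ^ j * coeff \<chi> (D - j) = of_int i"
    by (auto elim: Ints_cases)
  then have "of_rat (2 ^ j * coeff \<chi> (D - j)) = (of_int i :: real)"
    by simp
  then show "2 ^ j * coeff \<phi> (D - j) \<in> \<int>"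
    by (simp add: \<phi> of_rat_mult of_rat_power)
qed

end
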